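(* Let $n\ge 2$. Every $n$-ary group $(G,f)$ that is universal algebraically simple (UAS) is also group theoretically simple (GTS).
   Context: An $n$-ary group (polyadic group) is a nonempty set $G$ with an operation $f:G^n\to G$ that is associative, i.e. $f(x_1,\ldots,x_{i-1},f(x_i,\ldots,x_{n+i-1}),x_{n+i},\ldots,x_{2n-1})$ is independent of $i\in\{1,\ldots,n\}$ for all $x_1,\ldots,x_{2n-1}\in G$, and such that for all $a_1,\ldots,a_n,c\in G$ and $1\le i\le n$ there is a unique $x\in G$ with $f(a_1,\ldots,a_{i-1},x,a_{i+1},\ldots,a_n)=c$. The case $n=2$ is that of ordinary groups. For $x\in G$, the skew element $\overline{x}$ is the unique $y\in G$ with $f(x,\ldots,x,y)=x$ ($n-1$ copies of $x$ before $y$). A polyadic subgroup of $(G,f)$ is a nonempty subset $H\subseteq G$ that is itself an $n$-ary group under the restriction of $f$. It is a normal polyadic subgroup, written $H\unlhd(G,f)$, if $f(\overline{x},x,\ldots,x,h,x)\in H$ for all $x\in G$, $h\in H$, where $n-3$ copies of $x$ stand between $\overline{x}$ and $h$ (for $n=2$ this expression is read as the ordinary conjugate of $h$ by $x$, i.e. the product of the inverse of $x$, $h$ and $x$ in the group $(G,f)$). $(G,f)$ is group theoretically simple (GTS) if $H\unlhd(G,f)$ implies $|H|=1$ or $H=G$. A congruence of $(G,f)$ is an equivalence relation $R$ on $G$ such that (1) if $x_iRy_i$ for $i=1,\ldots,n$ then $f(x_1,\ldots,x_n)\,R\,f(y_1,\ldots,y_n)$; (2) $xRy$ implies $\overline{x}R\overline{y}$.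 $(G,f)$ is universal algebraically simple (UAS) if every congruence is either the equality relation or $G\times G$. *)

theory Defs
  imports "HOL-Algebra.Group"
begin

text \<open>
  An operation \<open>G\<^sup>n \<rightarrow> G\<close> is a function \<open>f :: 'a list \<Rightarrow> 'a\<close>, of which only the values on lists
  of length \<open>n\<close> with entries in the carrier \<open>G\<close> are relevant. Positions in lists are counted from \<open>0\<close>.
\<close>

definition tuples :: "nat \<Rightarrow> 'a set \<Rightarrow> 'a list set" where
  "tuples n G = {xs. length xs = n \<and> set xs \<subseteq> G}"

definition apply_at :: "nat \<Rightarrow> ('a list \<Rightarrow> 'a) \<Rightarrow> nat \<Rightarrow> 'a list \<Rightarrow> 'a" where
  "apply_at n f i xs = f (take i xs @ [f (take n (drop i xs))] @ drop (i + n) xs)"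

definition nary_group :: "nat \<Rightarrow> 'a set \<Rightarrow> ('a list \<Rightarrow> 'a) \<Rightarrow> bool" where
  "nary_group n G f \<longleftrightarrow>
     G \<noteq> {} \<and>
     (\<forall>xs \<in> tuples n G. f xs \<in> G) \<and>
     (\<forall>xs \<in> tuples (2 * n - 1) G. \<forall>i<n. \<forall>j<n. apply_at n f i xs = apply_at n f j xs) \<and>
     (\<forall>as \<in> tuples n G. \<forall>c \<in> G. \<forall>i<n. \<exists>!x. x \<in> G \<and> f (as[i := x]) = c)"

definition skew :: "nat \<Rightarrow> 'a set \<Rightarrow> ('a list \<Rightarrow> 'a) \<Rightarrow> 'a \<Rightarrow> 'a" where
  "skew n G f x = (THE y. y \<in> G \<and> f (replicate (n - 1) x @ [y]) = x)"

lemma skew_ex1: assumes "n\<ge>2" "nary_group n G f" "x\<in>G"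
  shows "\<exists>!y. y \<in> G \<and> f (replicate (n - 1) x @ [y]) = x"
proof -
  have "replicate n x \<in> tuples n G" using assms by (auto simp: tuples_def)
  hence "\<exists>!y. y \<in> G \<and> f ((replicate n x)[n-1 := y]) = x" 
    using assms unfolding nary_group_def by (elim conjE, elim ballE[where x="replicate n x"] ballE[where x=x] allE[where x="n-1"]) auto
  moreover have "\<And>y. (replicate n x)[n-1 := y] = replicate (n - 1) x @ [y]"
  proof -
    fix y
    show "(replicate n x)[n-1 := y] = replicate (n - 1) x @ [y]"
      using assms(1) by (intro nth_equalityI) (auto simp: nth_append nth_list_update less_Suc_eq)
  qed
  ultimately show ?thesis by simp
qed

definition polyadic_subgroup :: "nat \<Rightarrow> 'a set \<Rightarrow> 'a set \<Rightarrow> ('a list \<Rightarrow> 'a) \<Rightarrow> bool" where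
  "polyadic_subgroup n H G f \<longleftrightarrow> H \<noteq> {} \<and> H \<subseteq> G \<and> nary_group n H f"

text \<open>
  Conjugation for \<open>n = 2\<close> is taken in the following group; for \<open>n \<ge> 3\<close> it is expressed by \<open>f\<close>
  and skew elements.
\<close>

definition binary_group :: "'a set \<Rightarrow> ('a list \<Rightarrow> 'a) \<Rightarrow> 'a monoid" where
  "binary_group G f =
     \<lparr>carrier = G, monoid.mult = (\<lambda>x y. f [x, y]),
      one = (THE e. e \<in> G \<and> (\<forall>x\<in>G. f [e, x] = x \<and> f [x, e] = x))\<rparr>"

lemma group_binary_group: assumes g: "nary_group 2 G f" shows "group (binary_group G f)"
proof -
  have cl: "\<And>x y. x\<in>G \<Longrightarrow> y\<in>G \<Longrightarrow> f [x,y] \<in> G" using g by (auto simp: nary_group_def tuples_def)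
  have as: "f [f [x,y], z] = f [x, f [y,z]]" if "x\<in>G" "y\<in>G" "z\<in>G" for x y z
  proof -
    have "[x,y,z] \<in> tuples (2*2-1) G" using that by (auto simp: tuples_def)
    hence "apply_at 2 f 0 [x,y,z] = apply_at 2 f 1 [x,y,z]" using g by (simp add: nary_group_def numeral_2_eq_2)
    thus ?thesis by (simp add: apply_at_def numeral_2_eq_2)
  qed
  have L: "\<exists>!x. x\<in>G \<and> f [x,a] = c" and R: "\<exists>!x. x\<in>G \<and> f [a,x] = c" if "a\<in>G" "c\<in>G" for a c
  proof -
    have t: "[a,a] \<in> tuples 2 G" using that by (auto simp: tuples_def)
    have "\<And>i. i<2 \<Longrightarrow> \<exists>!x. x\<in>G \<and> f ([a,a][i:=x]) = c" using g t that unfolding nary_group_def by blast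
    from this[of 0] this[of 1] show "\<exists>!x. x\<in>G \<and> f [x,a] = c" "\<exists>!x. x\<in>G \<and> f [a,x] = c" by simp_all
  qed
  obtain a where a: "a\<in>G" using g by (auto simp: nary_group_def)
  obtain e where e: "e\<in>G" "f [e,a]=a" using L[OF a a] by blast
  have el: "f [e,x] = x" if "x\<in>G" for x using R[OF a that] e a as by metis
  have er: "f [x,e] = x" if "x\<in>G" for x
  proof -
    have "f [f [x,e], e] = f [x,e]" using as[OF that e(1) e(1)] el[OF e(1)] by simp
    thus ?thesis using L[OF e(1) cl[OF that e(1)]] that cl[OF that e(1)] by blast
  qed
  have the: "(THE e. e \<in> G \<and> (\<forall>x\<in>G. f [e, x] = x \<and> f [x, e] = x)) = e"
  proof (rule the_equality)
    show "e \<in> G \<and> (\<forall>x\<in>G. f [e, x] = x \<and> f [x, e] = x)" using e(1) el er by blast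
  next
    fix e' assume "e' \<in> G \<and> (\<forall>x\<in>G. f [e', x] = x \<and> f [x, e'] = x)"
    hence "e' \<in> G" "f [e', e] = e" using e(1) by auto
    thus "e' = e" using er[of e'] by simp
  qed
  show ?thesis unfolding binary_group_def the
  proof (rule groupI, simp_all add: cl as e(1) el)
    fix x assume "x \<in> G"
    thus "\<exists>y\<in>G. f [y, x] = e" using L[of x e] e(1) by blast
  qed
qed

definition nary_conj :: "nat \<Rightarrow> 'a set \<Rightarrow> ('a list \<Rightarrow> 'a) \<Rightarrow> 'a \<Rightarrow> 'a \<Rightarrow> 'a" where
  "nary_conj n G f x h =
     (if n = 2 then inv\<^bsub>binary_group G f\<^esub> x \<otimes>\<^bsub>binary_group G f\<^esub> h \<otimes>\<^bsub>binary_group G f\<^esub> x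
      else f ([skew n G f x] @ replicate (n - 3) x @ [h, x]))"

definition normal_polyadic_subgroup :: "nat \<Rightarrow> 'a set \<Rightarrow> 'a set \<Rightarrow> ('a list \<Rightarrow> 'a) \<Rightarrow> bool" where
  "normal_polyadic_subgroup n H G f \<longleftrightarrow>
     polyadic_subgroup n H G f \<and> (\<forall>x\<in>G. \<forall>h\<in>H. nary_conj n G f x h \<in> H)"

definition GTS :: "nat \<Rightarrow> 'a set \<Rightarrow> ('a list \<Rightarrow> 'a) \<Rightarrow> bool" where
  "GTS n G f \<longleftrightarrow> (\<forall>H. normal_polyadic_subgroup n H G f \<longrightarrow> card H = 1 \<or> H = G)"

definition nary_congruence :: "nat \<Rightarrow> 'a set \<Rightarrow> ('a list \<Rightarrow> 'a) \<Rightarrow> ('a \<times> 'a) set \<Rightarrow> bool" where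
  "nary_congruence n G f R \<longleftrightarrow>
     equiv G R \<and>
     (\<forall>xs \<in> tuples n G. \<forall>ys \<in> tuples n G.
        (\<forall>i<n. (xs ! i, ys ! i) \<in> R) \<longrightarrow> (f xs, f ys) \<in> R) \<and>
     (\<forall>x y. (x, y) \<in> R \<longrightarrow> (skew n G f x, skew n G f y) \<in> R)"

definition UAS :: "nat \<Rightarrow> 'a set \<Rightarrow> ('a list \<Rightarrow> 'a) \<Rightarrow> bool" where
  "UAS n G f \<longleftrightarrow> (\<forall>R. nary_congruence n G f R \<longrightarrow> R = Id_on G \<or> R = G \<times> G)"

end

theory Submission
  imports Defs
begin

text \<open>
  A normal polyadic subgroup \<open>H\<close> gives the relation ``\<open>y\<close> is the long product of \<open>x\<close> and a word
  over \<open>H\<close> whose length is divisible by \<open>n - 1\<close>'', the trace on \<open>G\<close> of the coset relation in the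
  Post cover. Since \<open>h x = x h\<^sup>x\<close>, where \<open>h\<^sup>x\<close> is the conjugate, such words can be moved past
  elements of \<open>G\<close>, so the relation is a congruence. The class of an element of \<open>H\<close> is \<open>H\<close>;
  hence \<open>H\<close> is a singleton if the congruence is equality and \<open>H = G\<close> if it is \<open>G \<times> G\<close>.
\<close>

section \<open>Words of admissible length and their long products\<close>

text \<open>From here on the arity is \<open>Suc m\<close>, so that admissible words have length \<open>1\<close> modulo \<open>m\<close>.\<close>

primrec contract :: "nat \<Rightarrow> ('a list \<Rightarrow> 'a) \<Rightarrow> nat \<Rightarrow> 'a list \<Rightarrow> 'a" where
  "contract m f 0 ws = hd ws"
| "contract m f (Suc k) ws = contract m f k (f (take (Suc m) ws) # drop (Suc m) ws)"

text \<open>Each application of \<open>f\<close> shortens the word by \<open>m\<close> letters, so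
  for an admissible word this number of steps leaves a single letter, which \<open>contract\<close>
  then returns as \<open>hd\<close>.\<close>

definition long_prod :: "nat \<Rightarrow> ('a list \<Rightarrow> 'a) \<Rightarrow> 'a list \<Rightarrow> 'a" where
  "long_prod m f ws = contract m f ((length ws - 1) div m) ws"

definition admissible :: "nat \<Rightarrow> 'a list \<Rightarrow> bool" where
  "admissible m ws \<longleftrightarrow> (\<exists>k. length ws = Suc (k * m))"

lemma set_replicate_subset [simp]: "x \<in> A \<Longrightarrow> set (replicate k x) \<subseteq> A"
  by auto

lemma admissibleI: "length ws = Suc (k * m) \<Longrightarrow> admissible m ws"
  by (auto simp: admissible_def)

lemma admissible_single [simp]: "admissible m [x]"
  by (rule admissibleI[where k = 0]) simp

lemma admissible_Suc: "length ws = Suc m \<Longrightarrow> admissible m ws"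
  by (rule admissibleI[where k = 1]) simp

lemma admissible_cong: "length u = length v \<Longrightarrow> admissible m u \<longleftrightarrow> admissible m v"
  by (simp add: admissible_def)

lemma admissible_add:
  assumes "admissible m u" "length v = length u + k * m"
  shows "admissible m v"
proof -
  obtain l where "length u = Suc (l * m)" using assms(1) by (auto simp: admissible_def)
  then have "length v = Suc ((l + k) * m)" using assms(2) by (simp add: algebra_simps)
  then show ?thesis by (rule admissibleI)
qed

lemma admissible_replace:
  assumes "admissible m (u @ x # w)" "admissible m v"
  shows "admissible m (u @ v @ w)"
proof -
  obtain l where "length v = Suc (l * m)" using assms(2) by (auto simp: admissible_def)
  then show ?thesis using admissible_add[OF assms(1), of "u @ v @ w" l] by simp
qed

section \<open>General associativity, cancellation and neutral words\<close>

locale polyadic_group =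
  fixes m :: nat and G :: "'a set" and f :: "'a list \<Rightarrow> 'a"
  assumes m_pos: "m \<ge> 1" and nary: "nary_group (Suc m) G f"
begin

abbreviation F where "F \<equiv> long_prod m f"

lemma nonempty: "\<exists>x. x \<in> G"
  using nary by (auto simp: nary_group_def)

lemma f_closed: "length xs = Suc m \<Longrightarrow> set xs \<subseteq> G \<Longrightarrow> f xs \<in> G"
  using nary by (auto simp: nary_group_def tuples_def)

lemma f_assoc:
  assumes "length u + length w = m" "length v = Suc m" "set (u @ v @ w) \<subseteq> G"
  shows "f (u @ f v # w) = f (f (take (Suc m) (u @ v @ w)) # drop (Suc m) (u @ v @ w))"
proof -
  let ?x = "u @ v @ w"
  have "?x \<in> tuples (2 * Suc m - 1) G" using assms by (auto simp: tuples_def)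
  moreover have "length u < Suc m" using assms by simp
  ultimately have "apply_at (Suc m) f (length u) ?x = apply_at (Suc m) f 0 ?x"
    using nary unfolding nary_group_def by blast
  then show ?thesis using assms by (simp add: apply_at_def)
qed

lemma f_ex1:
  assumes "length u + length w = m" "set u \<subseteq> G" "set w \<subseteq> G" "c \<in> G"
  shows "\<exists>!x. x \<in> G \<and> f (u @ x # w) = c"
proof -
  have "u @ c # w \<in> tuples (Suc m) G" "length u < Suc m" using assms by (auto simp: tuples_def)
  then have "\<exists>!x. x \<in> G \<and> f ((u @ c # w)[length u := x]) = c"
    using nary assms(4) unfolding nary_group_def by blast
  then show ?thesis by simp
qed

lemma f_solve:
  assumes "length u + length w = m" "set u \<subseteq> G" "set w \<subseteq> G" "c \<in> G"
  obtains x where "x \<in> G" "f (u @ x # w) = c"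
  using f_ex1[OF assms] by blast

lemma f_inj:
  assumes "length u + length w = m" "set u \<subseteq> G" "set w \<subseteq> G" "x \<in> G" "y \<in> G"
    "f (u @ x # w) = f (u @ y # w)"
  shows "x = y"
proof -
  have "f (u @ y # w) \<in> G" using assms by (intro f_closed) auto
  from f_ex1[OF assms(1-3) this] show ?thesis using assms by metis
qed

text \<open>General associativity, since \<open>contract\<close> itself always works at the left
  end. If the first \<open>Suc m\<close> letters lie in \<open>u\<close>, they are contracted first
  and the induction hypothesis applies. Otherwise \<open>v\<close> ends within the first
  \<open>2 * m + 1\<close> letters, and \<open>f_assoc\<close> applies to these.\<close>

lemma contract_window:
  assumes "length (u @ v @ w) = Suc (Suc k * m)" "length v = Suc m" "set (u @ v @ w) \<subseteq> G"
  shows "contract m f (Suc k) (u @ v @ w) = contract m f k (u @ f v # w)"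
  using assms
proof (induction k arbitrary: u w)
  case 0
  then have "u = []" "w = []" by auto
  then show ?case using 0 by simp
next
  case (Suc k)
  show ?case
  proof (cases "length u \<ge> Suc m")
    case True
    define u1 u2 where "u1 = take (Suc m) u" and "u2 = drop (Suc m) u"
    have u: "u = u1 @ u2" "length u1 = Suc m" using True by (auto simp: u1_def u2_def)
    have "f u1 \<in> G" using u Suc.prems by (intro f_closed) auto
    then have "contract m f (Suc k) ((f u1 # u2) @ v @ w) = contract m f k ((f u1 # u2) @ f v # w)"
      using u Suc.prems by (intro Suc.IH) auto
    then show ?thesis using u by simp
  next
    case False
    define w1 w2 where "w1 = take (m - length u) w" and "w2 = drop (m - length u) w"
    have "length u + length w = m + k * m" using Suc.prems by simp
    then have "m - length u \<le> length w" by linarith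
    then have w: "w = w1 @ w2" "length u + length w1 = m"
      using False by (auto simp: w1_def w2_def min_def)
    have as: "f (u @ f v # w1) = f (f (take (Suc m) (u @ v @ w1)) # drop (Suc m) (u @ v @ w1))"
      using Suc.prems w by (intro f_assoc) auto
    have l: "length (u @ v @ w1) = Suc (m + m)" using w Suc.prems by simp
    have "contract m f (Suc (Suc k)) (u @ v @ w) =
      contract m f (Suc (Suc k)) ((u @ v @ w1) @ w2)" using w by simp
    also have "\<dots> = contract m f k (f (u @ f v # w1) # w2)"
      unfolding as using l by (simp del: append_assoc)
    also have "\<dots> = contract m f (Suc k) ((u @ f v # w1) @ w2)"
      using w by (simp del: append_assoc)
    finally show ?thesis using w by simp
  qed
qed

lemma F_single [simp]: "F [x] = x"
  by (simp add: long_prod_def)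

lemma F_window:
  assumes "admissible m (u @ v @ w)" "length v = Suc m" "set (u @ v @ w) \<subseteq> G"
  shows "F (u @ f v # w) = F (u @ v @ w)"
proof -
  obtain k where k: "length (u @ v @ w) = Suc (k * m)" using assms(1) by (auto simp: admissible_def)
  then obtain l where l: "k = Suc l" using assms(2) m_pos by (cases k) auto
  have len: "length (u @ f v # w) = Suc (l * m)" using k l assms(2) by simp
  show ?thesis
    using contract_window[of u v w l] assms k l len m_pos
    by (simp add: long_prod_def del: contract.simps length_append)
qed

lemma F_tuple: "length v = Suc m \<Longrightarrow> set v \<subseteq> G \<Longrightarrow> F v = f v"
  using F_window[of "[]" v "[]"] by (simp add: admissible_Suc)

lemma F_split:
  assumes "length v = Suc (Suc k * m)" "set v \<subseteq> G"
  obtains a b where "v = a @ b" "length a = Suc m" "length (f a # b) = Suc (k * m)"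
    "set (f a # b) \<subseteq> G" "F v = F (f a # b)"
proof -
  define a b where ab: "a = take (Suc m) v" "b = drop (Suc m) v"
  have v: "v = a @ b" "length a = Suc m" "length (f a # b) = Suc (k * m)"
    using assms by (auto simp: ab)
  have "F v = F (f a # b)"
    using F_window[of "[]" a b] admissibleI[OF assms(1)] v assms by simp
  moreover have "set (f a # b) \<subseteq> G" using v assms f_closed[of a] by auto
  ultimately show thesis using that v by blast
qed

lemma F_closed:
  assumes "admissible m v" "set v \<subseteq> G"
  shows "F v \<in> G"
proof -
  obtain k where "length v = Suc (k * m)" using assms(1) by (auto simp: admissible_def)
  then show ?thesis using assms(2)
  proof (induction k arbitrary: v)
    case 0
    then show ?case by (cases v) auto
  next
    case (Suc k)
    from Suc.prems obtain a b where "length (f a # b) = Suc (k * m)" "set (f a # b) \<subseteq> G" "F v = F (f a # b)"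
      by (rule F_split)
    then show ?case using Suc.IH by metis
  qed
qed

text \<open>Induction on the number of applications of \<open>f\<close> in \<open>v\<close>: each
  contraction at the left end of \<open>v\<close> is also a contraction inside the whole word, by
  \<open>F_window\<close>.\<close>

lemma F_collapse:
  assumes "admissible m (u @ v @ w)" "admissible m v" "set (u @ v @ w) \<subseteq> G"
  shows "F (u @ F v # w) = F (u @ v @ w)"
proof -
  obtain k where "length v = Suc (k * m)" using assms(2) by (auto simp: admissible_def)
  then show ?thesis using assms(1,3)
  proof (induction k arbitrary: v)
    case 0
    then show ?case by (cases v) auto
  next
    case (Suc k)
    have "set v \<subseteq> G" using Suc.prems by simp
    with Suc.prems(1) obtain a b where ab: "v = a @ b" "length a = Suc m"
        "length (f a # b) = Suc (k * m)" "set (f a # b) \<subseteq> G" "F v = F (f a # b)"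
      by (rule F_split)
    obtain l where l: "length (u @ v @ w) = Suc (l * m)" using Suc.prems by (auto simp: admissible_def)
    then obtain l' where l': "l = Suc l'" using Suc.prems m_pos by (cases l) auto
    have adm: "admissible m (u @ (f a # b) @ w)"
      using l l' ab by (intro admissibleI[where k = l']) auto
    have "F (u @ F v # w) = F (u @ (f a # b) @ w)"
      unfolding ab(5) using Suc.prems ab adm by (intro Suc.IH) auto
    also have "\<dots> = F (u @ a @ b @ w)"
      using F_window[of u a "b @ w"] Suc.prems ab by simp
    finally show ?case using ab by simp
  qed
qed

text \<open>A window of \<open>Suc m\<close> letters around the unknown is contracted to one letter.
  The induction hypothesis identifies the two values of the window, and \<open>f_inj\<close> then
  identifies the unknowns.\<close>

lemma F_inj:
  assumes "length u + length w = k * m" "set u \<subseteq> G" "set w \<subseteq> G" "x \<in> G" "y \<in> G"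
    "F (u @ x # w) = F (u @ y # w)"
  shows "x = y"
  using assms
proof (induction k arbitrary: u w x y)
  case 0
  then show ?case by simp
next
  case (Suc k)
  \<comment> \<open>The window takes \<open>j\<close> letters from the left of the unknown, as many
    as possible up to \<open>m\<close>, and the other \<open>m - j\<close> from the right.\<close>
  define j where "j = min (length u) m"
  define u1 u2 where "u1 = take (length u - j) u" and "u2 = drop (length u - j) u"
  define w1 w2 where "w1 = take (m - j) w" and "w2 = drop (m - j) w"
  have j: "j \<le> length u" "j \<le> m" by (auto simp: j_def)
  have "m - j \<le> length w" using Suc.prems(1) by (auto simp: j_def min_def)
  then have uw: "u = u1 @ u2" "w = w1 @ w2" "length u2 + length w1 = m"
    using j by (auto simp: u1_def u2_def w1_def w2_def)
  have contr: "F (u @ z # w) = F (u1 @ f (u2 @ z # w1) # w2)" if "z \<in> G" for z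
  proof -
    have "admissible m (u @ z # w)" using Suc.prems(1) by (intro admissibleI[where k = "Suc k"]) simp
    then show ?thesis using F_window[of u1 "u2 @ z # w1" w2] that Suc.prems uw by simp
  qed
  have "f (u2 @ x # w1) = f (u2 @ y # w1)"
  proof (rule Suc.IH)
    show "length u1 + length w2 = k * m" using uw Suc.prems(1) by simp
    show "f (u2 @ x # w1) \<in> G" "f (u2 @ y # w1) \<in> G" using uw Suc.prems by (auto intro!: f_closed)
    show "F (u1 @ f (u2 @ x # w1) # w2) = F (u1 @ f (u2 @ y # w1) # w2)"
      using contr Suc.prems by metis
  qed (use Suc.prems uw in auto)
  then show ?case using f_inj[of u2 w1 x y] uw Suc.prems by auto
qed

text \<open>Cancellation for words: \<open>a\<close> and \<open>b\<close> collapse to single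
  letters, to which \<open>F_inj\<close> applies. The letter \<open>x\<close> serves to record that
  the lengths of \<open>u\<close> and \<open>w\<close> add up to a multiple of
  \<open>m\<close>.\<close>

lemma F_cancel:
  assumes "admissible m a" "admissible m b" "admissible m (u @ x # w)"
    "set (u @ a @ w) \<subseteq> G" "set b \<subseteq> G" "F (u @ a @ w) = F (u @ b @ w)"
  shows "F a = F b"
proof -
  obtain k where k: "length (u @ x # w) = Suc (k * m)" using assms(3) by (auto simp: admissible_def)
  have "F (u @ F a # w) = F (u @ F b # w)"
    using assms F_collapse[of u a w] F_collapse[of u b w] admissible_replace[OF assms(3)] by auto
  then show ?thesis using F_inj[of u w k "F a" "F b"] k assms F_closed by auto
qed

text \<open>Fixing one element makes \<open>e\<close> the identity of the Post cover: every
  \<open>y\<close> is a product ending in \<open>x\<close>, so \<open>y\<close> absorbs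
  \<open>e\<close> on its right, and cancellation gives the same on its left.\<close>

lemma neutral_word:
  assumes e: "F (x # e) = x" "x \<in> G" "set e \<subseteq> G" "length e = k * m"
    and ps: "set p \<subseteq> G" "set s \<subseteq> G" "admissible m (p @ s)"
  shows "F (p @ e @ s) = F (p @ s)"
proof -
  have adm: "admissible m (y # e)" "admissible m (e @ [y])" for y
    using e(4) by (auto intro: admissibleI[where k = k])
  obtain l where l: "m = Suc l" using m_pos by (cases m) auto
  have right: "F (y # e) = y" if y: "y \<in> G" for y
  proof -
    \<comment> \<open>Writing \<open>y\<close> as a product that ends in \<open>x\<close> lets the
      known equation for \<open>x\<close> act on \<open>e\<close>.\<close>
    obtain g where g: "g \<in> G" "f ([] @ g # replicate m x) = y"
      using f_solve[of "[]" "replicate m x" y] e(2) y by auto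
    let ?a = "g # replicate l x"
    have rep: "?a @ [x] = g # replicate m x"
      using l by (simp add: replicate_append_same)
    have a: "set ?a \<subseteq> G" using g e(2) by auto
    have adm2: "admissible m (?a @ x # e)"
      using e(4) l by (intro admissibleI[where k = "Suc k"]) simp
    have "F (y # e) = F ([] @ f (?a @ [x]) # e)" using g rep by simp
    also have "\<dots> = F ([] @ (?a @ [x]) @ e)"
      using adm2 a e l by (intro F_window) auto
    also have "\<dots> = F (?a @ F (x # e) # [])"
      using F_collapse[of ?a "x # e" "[]"] adm2 adm a e by simp
    also have "\<dots> = f (?a @ [x])" using e a l F_tuple[of "?a @ [x]"] by simp
    finally show ?thesis using g rep by simp
  qed
  \<comment> \<open>Cancel \<open>y\<^sup>m\<close> from \<open>y\<^sup>m e y = y\<^sup>m y\<close>, which holds as \<open>y e = y\<close>.\<close>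
  have left: "F (e @ [y]) = y" if y: "y \<in> G" for y
  proof -
    have eq: "F (replicate m y @ (e @ [y]) @ []) = F (replicate m y @ [y] @ [])"
    proof -
      obtain r where r: "replicate m y = r @ [y]" "set r \<subseteq> G" "length r = l"
        using that[of "replicate l y"] l y by (auto simp: replicate_append_same)
      have "admissible m (r @ (y # e) @ [y])"
        using r l e(4) by (intro admissibleI[where k = "Suc k"]) auto
      then have "F (r @ F (y # e) # [y]) = F (r @ (y # e) @ [y])"
        using r y e adm by (intro F_collapse) auto
      then show ?thesis using r right[OF y] by simp
    qed
    have "F (e @ [y]) = F [y]"
      by (rule F_cancel[where u = "replicate m y" and w = "[]" and x = y])
        (use eq adm y e in \<open>auto simp: admissible_Suc\<close>)
    then show ?thesis by simp
  qed
  show ?thesis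
  \<comment> \<open>The last letter of \<open>p\<close> absorbs \<open>e\<close>. If
    \<open>p\<close> is empty, admissibility makes \<open>s\<close> nonempty and its first letter
    absorbs \<open>e\<close>.\<close>
  proof (cases p rule: rev_cases)
    case Nil
    then obtain y t where s: "s = y # t" using ps(3) by (cases s) (auto simp: admissible_def)
    have "F ([] @ F (e @ [y]) # t) = F ([] @ (e @ [y]) @ t)"
    proof (rule F_collapse)
      show "admissible m ([] @ (e @ [y]) @ t)"
        by (rule admissible_add[OF ps(3), where k = k]) (use e(4) s Nil in simp)
    qed (use adm s ps e in auto)
    then show ?thesis using Nil s left ps by simp
  next
    case (snoc t y)
    have "F (t @ F (y # e) # s) = F (t @ (y # e) @ s)"
    proof (rule F_collapse)
      show "admissible m (t @ (y # e) @ s)"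
        by (rule admissible_add[OF ps(3), where k = k]) (use e(4) snoc in simp)
    qed (use adm snoc ps e in auto)
    then show ?thesis using snoc right ps by simp
  qed
qed

section \<open>Skew elements and conjugation\<close>

lemma skew_closed: "x \<in> G \<Longrightarrow> skew (Suc m) G f x \<in> G"
  and f_skew: "x \<in> G \<Longrightarrow> f (replicate m x @ [skew (Suc m) G f x]) = x"
  using theI'[OF skew_ex1[of "Suc m" G f x]] m_pos nary by (auto simp: skew_def)

text \<open>The relation \<open>h x = x h^x\<close> for arity at least 3. In the Post cover the
  conjugate is \<open>y x^(m-2) h x\<close> with \<open>y\<close> the skew element of
  \<open>x\<close>; preceded by \<open>x\<close>, its initial part becomes the neutral word
  \<open>x y x^(m-2)\<close>.\<close>

lemma F_skew_conj:
  assumes m: "m \<ge> 2" and x: "x \<in> G" and h: "h \<in> G"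
    and ps: "set p \<subseteq> G" "set s \<subseteq> G" "admissible m (p @ [h, x] @ s)"
  shows "F (p @ [x, nary_conj (Suc m) G f x h] @ s) = F (p @ [h, x] @ s)"
proof -
  define y where "y = skew (Suc m) G f x"
  have y: "y \<in> G" "f (replicate m x @ [y]) = x" using skew_closed f_skew x by (auto simp: y_def)
  \<comment> \<open>With arity \<open>n = Suc m\<close>, \<open>l\<close> is the number
    \<open>n - 3\<close> of copies of \<open>x\<close> in the conjugate.\<close>
  obtain l where l: "m = Suc (Suc l)" using m by (metis add_2_eq_Suc le_Suc_ex)
  \<comment> \<open>In the Post cover \<open>y = x\<close> to the power \<open>1 - m\<close>, so \<open>?e\<close> represents the identity.\<close>
  let ?e = "[x, y] @ replicate l x"
  \<comment> \<open>One letter of \<open>x^(m+1)\<close> is replaced by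
    \<open>f (replicate m x @ [y])\<close>. Regrouping the powers puts \<open>x # ?e\<close> between
    \<open>x^(m-1)\<close> and \<open>x\<close>, which can be cancelled.\<close>
  have eq: "F (replicate (Suc l) x @ (x # ?e) @ [x]) = F (replicate (Suc l) x @ [x] @ [x])"
  proof -
    have "F ([x] @ f (replicate m x @ [y]) # replicate (Suc l) x)
        = F ([x] @ (replicate m x @ [y]) @ replicate (Suc l) x)"
      using x y l by (intro F_window admissibleI[where k = 2]) auto
    moreover have "[x] @ (replicate m x @ [y]) @ replicate (Suc l) x
        = replicate (Suc l) x @ (x # ?e) @ [x]"
      unfolding l by (simp add: replicate_app_Cons_same replicate_append_same)
    moreover have "[x] @ x # replicate (Suc l) x = replicate (Suc l) x @ [x] @ [x]"
      by (simp add: replicate_app_Cons_same replicate_append_same)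
    ultimately show ?thesis using y(2) by metis
  qed
  have "F (x # ?e) = F [x]"
    by (rule F_cancel[OF _ _ _ _ _ eq, where x = x])
      (use x y(1) l in \<open>auto intro!: admissible_Suc\<close>)
  then have "F (x # ?e) = x" by simp
  then have ne: "F (p @ ?e @ [h, x] @ s) = F (p @ [h, x] @ s)"
    using neutral_word[of x ?e 1 p "[h, x] @ s"] x y(1) ps l h by auto
  have c: "nary_conj (Suc m) G f x h = f ([y] @ replicate l x @ [h, x])"
    using l by (simp add: nary_conj_def y_def)
  have "F ((p @ [x]) @ f ([y] @ replicate l x @ [h, x]) # s)
      = F ((p @ [x]) @ ([y] @ replicate l x @ [h, x]) @ s)"
  proof (rule F_window)
    show "admissible m ((p @ [x]) @ ([y] @ replicate l x @ [h, x]) @ s)"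
      by (rule admissible_add[OF ps(3), where k = 1]) (use l in simp)
  qed (use x y(1) h ps l in auto)
  then show ?thesis using ne c by simp
qed

text \<open>Joins the two readings of the conjugate: for \<open>m = 1\<close> the relation is the
  group identity \<open>x (inv x h x) = h x\<close>, otherwise it is
  \<open>F_skew_conj\<close>.\<close>

lemma F_nary_conj:
  assumes x: "x \<in> G" and h: "h \<in> G"
    and ps: "set p \<subseteq> G" "set s \<subseteq> G" "admissible m (p @ [h, x] @ s)"
    and c: "nary_conj (Suc m) G f x h \<in> G"
  shows "F (p @ [x, nary_conj (Suc m) G f x h] @ s) = F (p @ [h, x] @ s)"
proof (cases "m = 1")
  case False
  then show ?thesis using F_skew_conj[OF _ x h ps] m_pos by simp
next
  case True
  let ?c = "nary_conj (Suc m) G f x h"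
  interpret B: group "binary_group G f"
    using group_binary_group nary True by (metis One_nat_def Suc_1)
  have carr: "carrier (binary_group G f) = G" by (simp add: binary_group_def)
  have mult: "a \<otimes>\<^bsub>binary_group G f\<^esub> b = f [a, b]" for a b by (simp add: binary_group_def)
  have "x \<in> carrier (binary_group G f)" "h \<in> carrier (binary_group G f)"
    using x h carr by simp_all
  then have "x \<otimes>\<^bsub>binary_group G f\<^esub> ?c = h \<otimes>\<^bsub>binary_group G f\<^esub> x"
    using True by (simp add: nary_conj_def numeral_2_eq_2 flip: B.m_assoc)
  then have "f [x, ?c] = f [h, x]" by (simp add: mult)
  moreover have "F (p @ f [a, b] # s) = F (p @ [a, b] @ s)" if "a \<in> G" "b \<in> G" for a b
    using that ps True by (intro F_window) (auto simp: admissible_def)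
  ultimately show ?thesis using x h c by metis
qed

end

section \<open>The coset relation of a normal polyadic subgroup is a congruence\<close>

locale normal_polyadic = polyadic_group +
  fixes H :: "'a set"
  assumes normal: "normal_polyadic_subgroup (Suc m) H G f"
begin

lemma H_sub: "H \<subseteq> G"
  using normal by (simp add: normal_polyadic_subgroup_def polyadic_subgroup_def)

lemma conj_closed: "x \<in> G \<Longrightarrow> h \<in> H \<Longrightarrow> nary_conj (Suc m) G f x h \<in> H"
  using normal by (simp add: normal_polyadic_subgroup_def)

text \<open>As \<open>long_prod\<close> does not depend on the carrier, \<open>F\<close> is the same
  function for \<open>H\<close> and \<open>G\<close>, and results on long products hold inside
  \<open>H\<close> too.\<close>

sublocale H: polyadic_group m H f
  using normal m_pos by unfold_locales (auto simp: normal_polyadic_subgroup_def polyadic_subgroup_def)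

text \<open>These lengths are the ones that keep a word admissible when appended to a letter. In the
  Post cover of \<open>H\<close> such words represent the elements of degree 0, which form an
  ordinary group.\<close>

definition words :: "'a list set" where
  "words = {hs. set hs \<subseteq> H \<and> (\<exists>k. length hs = k * m)}"

definition coset_rel :: "('a \<times> 'a) set" where
  "coset_rel = {(x, y). x \<in> G \<and> (\<exists>hs \<in> words. y = F (x # hs))}"

lemma words_sub: "hs \<in> words \<Longrightarrow> set hs \<subseteq> H" "hs \<in> words \<Longrightarrow> set hs \<subseteq> G"
  using H_sub by (auto simp: words_def)

lemma words_append: "a \<in> words \<Longrightarrow> b \<in> words \<Longrightarrow> a @ b \<in> words"
  by (auto simp: words_def simp flip: add_mult_distrib)

lemma words_admissible: "hs \<in> words \<Longrightarrow> admissible m (x # hs)"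
  by (auto simp: words_def admissible_def)

lemma words_insert:
  assumes "hs \<in> words" "admissible m (u @ w)"
  shows "admissible m (u @ hs @ w)"
proof -
  obtain k where "length hs = k * m" using assms(1) by (auto simp: words_def)
  then show ?thesis using admissible_add[OF assms(2), of "u @ hs @ w" k] by simp
qed

lemma coset_rel_sub: "(x, y) \<in> coset_rel \<Longrightarrow> x \<in> G \<and> y \<in> G"
  using F_closed words_admissible words_sub by (fastforce simp: coset_rel_def)

text \<open>The equation \<open>f (replicate m h @ [z]) = h'\<close> is solved inside
  \<open>H\<close>; all letters after the first \<open>h\<close> form the word.\<close>

lemma H_word_between:
  assumes "h \<in> H" "h' \<in> H"
  obtains hs where "hs \<in> words" "F (h # hs) = h'"
proof -
  obtain l where l: "m = Suc l" using m_pos by (cases m) auto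
  obtain z where z: "z \<in> H" "f (replicate m h @ [z]) = h'"
    using H.f_solve[of "replicate m h" "[]" h'] assms by auto
  let ?hs = "replicate l h @ [z]"
  have "length ?hs = 1 * m" using l by simp
  then have "?hs \<in> words" using z assms unfolding words_def by (auto simp del: length_append)
  moreover have "F (h # ?hs) = h'"
    using H.F_tuple[of "h # ?hs"] z assms l by auto
  ultimately show thesis by (rule that)
qed

text \<open>An inverse of \<open>hs\<close> is found inside \<open>H\<close>: choose
  \<open>ks\<close> leading from \<open>F (h # hs)\<close> back to \<open>h\<close>. Then
  \<open>hs @ ks\<close> fixes \<open>h\<close>, so it is neutral by \<open>neutral_word\<close>,
  and \<open>ks\<close> also leads from \<open>y\<close> back to \<open>x\<close>.\<close>

lemma coset_rel_sym:
  assumes "(x, y) \<in> coset_rel"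
  shows "(y, x) \<in> coset_rel"
proof -
  obtain hs where x: "x \<in> G" and hs: "hs \<in> words" "y = F (x # hs)"
    using assms by (auto simp: coset_rel_def)
  obtain h where h: "h \<in> H" using H.nonempty by blast
  have "F (h # hs) \<in> H" using h words_sub[OF hs(1)] words_admissible[OF hs(1)] by (intro H.F_closed) auto
  then obtain ks where ks: "ks \<in> words" "F (F (h # hs) # ks) = h"
    using h by (rule H_word_between)
  have hsks: "hs @ ks \<in> words" using hs ks words_append by blast
  have collapse: "F (F (z # hs) # ks) = F (z # hs @ ks)" if "z \<in> G" for z
    using F_collapse[of "[]" "z # hs" ks] words_admissible hsks hs ks that words_sub by auto
  obtain k where k: "length (hs @ ks) = k * m" using hsks by (auto simp: words_def)
  have "F (h # hs @ ks) = h" using collapse[of h] h H_sub ks by auto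
  then have "F ([] @ (hs @ ks) @ [x]) = F ([] @ [x]) \<and> F ([x] @ (hs @ ks) @ []) = F ([x] @ [])"
    using k words_sub[OF hsks] h H_sub x
    by (intro conjI neutral_word[where x = h and k = k]) auto
  then have "F (y # ks) = x" using collapse[OF x] hs by simp
  then show ?thesis using coset_rel_sub[OF assms] ks by (auto simp: coset_rel_def)
qed

lemma coset_rel_equiv: "equiv G coset_rel"
proof (rule equivI)
  have "[] \<in> words" by (auto simp: words_def intro: exI[of _ 0])
  then show "refl_on G coset_rel"
    using coset_rel_sub by (auto simp: refl_on_def coset_rel_def intro!: bexI[of _ "[]"])
  show "sym coset_rel" using coset_rel_sym by (auto intro: symI)
  show "trans coset_rel"
  proof (rule transI)
    fix x y z assume "(x, y) \<in> coset_rel" "(y, z) \<in> coset_rel"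
    then obtain hs ks where *: "x \<in> G" "hs \<in> words" "ks \<in> words" "y = F (x # hs)" "z = F (y # ks)"
      by (auto simp: coset_rel_def)
    then have "z = F (x # hs @ ks)"
      using F_collapse[of "[]" "x # hs" ks] words_admissible words_append[of hs ks] words_sub by auto
    then show "(x, z) \<in> coset_rel" using * words_append by (auto simp: coset_rel_def)
  qed
  show "coset_rel \<subseteq> G \<times> G" using coset_rel_sub by auto
qed

text \<open>The letters of \<open>hs\<close> pass \<open>x\<close> one at a time, the last one
  first, each turning into its conjugate by \<open>x\<close>, which normality keeps in
  \<open>H\<close>. The same \<open>ks\<close> serves every context \<open>p\<close>,
  \<open>s\<close>.\<close>

lemma word_commute:
  assumes "set hs \<subseteq> H" "x \<in> G"
  obtains ks where "set ks \<subseteq> H" "length ks = length hs"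
    "\<And>p s. set p \<subseteq> G \<Longrightarrow> set s \<subseteq> G \<Longrightarrow> admissible m (p @ hs @ x # s) \<Longrightarrow>
       F (p @ hs @ x # s) = F (p @ x # ks @ s)"
proof -
  have "\<exists>ks. set ks \<subseteq> H \<and> length ks = length hs \<and>
    (\<forall>p s. set p \<subseteq> G \<longrightarrow> set s \<subseteq> G \<longrightarrow> admissible m (p @ hs @ x # s) \<longrightarrow>
       F (p @ hs @ x # s) = F (p @ x # ks @ s))"
    using assms(1)
  proof (induction hs)
    case Nil
    then show ?case by auto
  next
    case (Cons h hs)
    then obtain ks where ks: "set ks \<subseteq> H" "length ks = length hs"
      "\<And>p s. set p \<subseteq> G \<Longrightarrow> set s \<subseteq> G \<Longrightarrow> admissible m (p @ hs @ x # s) \<Longrightarrow>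
         F (p @ hs @ x # s) = F (p @ x # ks @ s)" by auto
    let ?c = "nary_conj (Suc m) G f x h"
    have c: "?c \<in> H" using conj_closed assms(2) Cons.prems by simp
    have "F (p @ (h # hs) @ x # s) = F (p @ x # (?c # ks) @ s)"
      if ps: "set p \<subseteq> G" "set s \<subseteq> G" "admissible m (p @ (h # hs) @ x # s)" for p s
    proof -
      have h: "h \<in> G" using Cons.prems H_sub by auto
      have "F ((p @ [h]) @ hs @ x # s) = F ((p @ [h]) @ x # ks @ s)"
        using ps h by (intro ks(3)) auto
      also have "\<dots> = F (p @ [h, x] @ ks @ s)" by simp
      also have "\<dots> = F (p @ [x, ?c] @ ks @ s)"
      proof (rule F_nary_conj[symmetric])
        show "admissible m (p @ [h, x] @ ks @ s)"
          using ps(3) ks(2) by (subst admissible_cong) auto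
      qed (use ps ks h assms(2) c H_sub in auto)
      finally show ?thesis by simp
    qed
    then show ?case using ks c by (intro exI[of _ "?c # ks"]) auto
  qed
  then show thesis using that by blast
qed

text \<open>Each related letter contributes a word over \<open>H\<close>; all of these are gathered
  to the right of \<open>xs\<close> into one word. Leaving \<open>s\<close> arbitrary lets the
  induction append further letters.\<close>

lemma coset_rel_words:
  assumes "list_all2 (\<lambda>x y. (x, y) \<in> coset_rel) xs ys"
  shows "\<exists>hs \<in> words. \<forall>s. set s \<subseteq> G \<longrightarrow> admissible m (ys @ s) \<longrightarrow> F (ys @ s) = F (xs @ hs @ s)"
  using assms
proof (induction xs arbitrary: ys rule: rev_induct)
  case Nil
  moreover have "[] \<in> words" by (auto simp: words_def intro: exI[of _ 0])
  ultimately show ?case by force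
next
  case (snoc x xs)
  then obtain zs y where ys: "ys = zs @ [y]" "list_all2 (\<lambda>x y. (x, y) \<in> coset_rel) xs zs"
      "(x, y) \<in> coset_rel"
    by (auto simp: list_all2_append1 list_all2_Cons1)
  obtain hs where hs: "hs \<in> words"
      "\<And>s. set s \<subseteq> G \<Longrightarrow> admissible m (zs @ s) \<Longrightarrow> F (zs @ s) = F (xs @ hs @ s)"
    using snoc.IH[OF ys(2)] by blast
  obtain ks where ks: "x \<in> G" "ks \<in> words" "y = F (x # ks)" using ys(3) by (auto simp: coset_rel_def)
  \<comment> \<open>The word \<open>hs\<close> gathered from the earlier letters is moved past
    \<open>x\<close> and becomes \<open>ls\<close>; the word \<open>ks\<close> of the last letter
    follows it.\<close>
  obtain ls where ls: "set ls \<subseteq> H" "length ls = length hs"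
    "\<And>p s. set p \<subseteq> G \<Longrightarrow> set s \<subseteq> G \<Longrightarrow> admissible m (p @ hs @ x # s) \<Longrightarrow>
       F (p @ hs @ x # s) = F (p @ x # ls @ s)"
    using words_sub(1)[OF hs(1)] ks(1) by (rule word_commute) blast
  have lsw: "ls \<in> words" using ls hs(1) by (auto simp: words_def)
  have sets: "set xs \<subseteq> G" "set zs \<subseteq> G" "length xs = length zs"
    using ys(2) coset_rel_sub by (fastforce simp: list_all2_conv_all_nth in_set_conv_nth)+
  have "F (ys @ s) = F ((xs @ [x]) @ (ls @ ks) @ s)" if s: "set s \<subseteq> G" "admissible m (ys @ s)" for s
  proof -
    have adm: "admissible m (zs @ (x # ks) @ s)"
      using admissible_replace[of m zs y s "x # ks"] s ys words_admissible ks(2) by simp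
    have "admissible m (xs @ x # ks @ s)"
      using adm sets(3) by (subst admissible_cong) auto
    then have adm2: "admissible m (xs @ hs @ x # ks @ s)"
      using words_insert[OF hs(1)] by blast
    have "F (ys @ s) = F (zs @ F (x # ks) # s)" using ys ks by simp
    also have "\<dots> = F (zs @ (x # ks) @ s)"
      using adm words_admissible ks words_sub s sets by (intro F_collapse) auto
    also have "\<dots> = F (xs @ hs @ (x # ks) @ s)"
      using adm words_sub[OF ks(2)] ks(1) s by (intro hs(2)) auto
    also have "\<dots> = F (xs @ x # ls @ ks @ s)"
      using ls(3)[of xs "ks @ s"] adm2 words_sub[OF ks(2)] s sets by simp
    finally show ?thesis by simp
  qed
  then show ?case using words_append[OF lsw ks(2)] by blast
qed

lemma coset_rel_f:
  assumes "xs \<in> tuples (Suc m) G" "ys \<in> tuples (Suc m) G"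
    and rel: "\<And>i. i < Suc m \<Longrightarrow> (xs ! i, ys ! i) \<in> coset_rel"
  shows "(f xs, f ys) \<in> coset_rel"
proof -
  have t: "length xs = Suc m" "set xs \<subseteq> G" "length ys = Suc m" "set ys \<subseteq> G"
    using assms by (auto simp: tuples_def)
  have "list_all2 (\<lambda>x y. (x, y) \<in> coset_rel) xs ys"
    using t rel by (simp add: list_all2_conv_all_nth)
  then obtain hs where hs: "hs \<in> words"
      "\<And>s. set s \<subseteq> G \<Longrightarrow> admissible m (ys @ s) \<Longrightarrow> F (ys @ s) = F (xs @ hs @ s)"
    using coset_rel_words by blast
  have "f ys = F (xs @ hs)" using hs(2)[of "[]"] t F_tuple[of ys] admissible_Suc[of ys] by simp
  also have "\<dots> = F (f xs # hs)"
    using F_window[of "[]" xs hs] words_insert[OF hs(1), of xs "[]"] t words_sub[OF hs(1)]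
    by (simp add: admissible_Suc)
  finally show ?thesis using t f_closed hs(1) by (auto simp: coset_rel_def)
qed

text \<open>Compatibility with \<open>f\<close> relates \<open>f (replicate m y @ [?x])\<close> to
  \<open>x\<close>, hence to \<open>y\<close>. So some \<open>hs\<close> gives
  \<open>y = f (replicate m y @ [F (?x # hs)])\<close>, and uniqueness of the skew element yields
  \<open>?y = F (?x # hs)\<close>.\<close>

lemma coset_rel_skew:
  assumes "(x, y) \<in> coset_rel"
  shows "(skew (Suc m) G f x, skew (Suc m) G f y) \<in> coset_rel"
proof -
  let ?x = "skew (Suc m) G f x" and ?y = "skew (Suc m) G f y"
  have xy: "x \<in> G" "y \<in> G" "?x \<in> G" "?y \<in> G"
    using coset_rel_sub[OF assms] skew_closed by auto
  have refl: "(?x, ?x) \<in> coset_rel"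
    using coset_rel_equiv xy(3) by (simp add: equiv_def refl_on_def)
  have "(f (replicate m x @ [?x]), f (replicate m y @ [?x])) \<in> coset_rel"
    using xy assms refl by (intro coset_rel_f) (auto simp: tuples_def nth_append)
  then have "(x, f (replicate m y @ [?x])) \<in> coset_rel" using f_skew xy by simp
  then have "(f (replicate m y @ [?x]), y) \<in> coset_rel"
    using assms coset_rel_equiv by (meson equivE symE transE)
  then obtain hs where hs: "hs \<in> words" "y = F (f (replicate m y @ [?x]) # hs)"
    by (auto simp: coset_rel_def)
  have adm: "admissible m (replicate m y @ [?x] @ hs)"
    using words_insert[OF hs(1), of "replicate m y @ [?x]" "[]"] by (simp add: admissible_Suc)
  have z: "F (?x # hs) \<in> G" using F_closed words_admissible words_sub hs(1) xy by auto
  have "f (replicate m y @ ?y # []) = F ([] @ f (replicate m y @ [?x]) # hs)"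
    using f_skew xy hs by simp
  also have "\<dots> = F ([] @ (replicate m y @ [?x]) @ hs)"
    using adm xy words_sub[OF hs(1)] by (intro F_window) auto
  also have "\<dots> = F (replicate m y @ F (?x # hs) # [])"
    using F_collapse[of "replicate m y" "?x # hs" "[]"] adm xy words_sub[OF hs(1)]
      words_admissible[OF hs(1)] by simp
  also have "\<dots> = f (replicate m y @ F (?x # hs) # [])"
    using z xy by (intro F_tuple) auto
  finally have "?y = F (?x # hs)"
    using f_inj[of "replicate m y" "[]" ?y "F (?x # hs)"] z xy by auto
  then show ?thesis using xy hs(1) by (auto simp: coset_rel_def)
qed

lemma coset_rel_congruence: "nary_congruence (Suc m) G f coset_rel"
  using coset_rel_equiv coset_rel_f coset_rel_skew by (auto simp: nary_congruence_def)

text \<open>Closure of \<open>H\<close> under long products gives one direction,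
  \<open>H_word_between\<close> the other.\<close>

lemma coset_rel_H: "h \<in> H \<Longrightarrow> (h, x) \<in> coset_rel \<longleftrightarrow> x \<in> H"
proof
  assume h: "h \<in> H" "(h, x) \<in> coset_rel"
  then show "x \<in> H" using H.F_closed words_admissible words_sub by (fastforce simp: coset_rel_def)
next
  assume "h \<in> H" "x \<in> H"
  then show "(h, x) \<in> coset_rel" using H_sub by (auto simp: coset_rel_def elim: H_word_between)
qed

end

section \<open>From congruences back to normal polyadic subgroups\<close>

theorem proposition2p7:
  fixes n :: nat and G :: "'a set" and f :: "'a list \<Rightarrow> 'a"
  assumes "n \<ge> 2"
    and "nary_group n G f"
    and "UAS n G f"
  shows "GTS n G f"
  unfolding GTS_def
proof (intro allI impI)
  fix H assume H: "normal_polyadic_subgroup n H G f"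
  obtain m where n: "n = Suc m" "m \<ge> 1" using assms(1) by (cases n) auto
  interpret normal_polyadic m G f H
    using n assms(2) H by unfold_locales auto
  obtain h where h: "h \<in> H" using H.nonempty by blast
  have "coset_rel = Id_on G \<or> coset_rel = G \<times> G"
    using assms(3) coset_rel_congruence n by (simp add: UAS_def)
  then show "card H = 1 \<or> H = G"
  proof
    assume "coset_rel = Id_on G"
    then have "H = {h}" using coset_rel_H[OF h] h by auto
    then show ?thesis by simp
  next
    assume "coset_rel = G \<times> G"
    then have "H = G" using coset_rel_H[OF h] h H_sub by auto
    then show ?thesis by simp
  qed
qed

end
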